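(* Let $n\ge 1$ and let $T$ be an $n\times n$ random matrix with real entries such that each diagonal entry $T_{i,i}$ ($1\le i\le n$) is a continuous random variable, independent from all the other entries of $T$. Let $b>0$ be a uniform upper bound on the densities of $T_{1,1},\dots,T_{n,n}$. Then for every (deterministic) real $n\times n$ matrix $A$ and every $t\ge 0$, $$\mathbb P\Big[|\det(A+T)|^{1/n}\le t\Big]\le 2bnt.$$
   Context: A continuous random variable is a real random variable whose law has a density with respect to Lebesgue measure. "$T_{i,i}$ is independent from all the other entries of $T$" means that $T_{i,i}$ is independent of the joint family $(T_{k,l})_{(k,l)\ne(i,i)}$. No independence is assumed among the off-diagonal entries, and they need not have densities. *)

theory Defs
  imports "HOL-Probability.Probability"
begin

definition other_entries :: "'n::finite \<Rightarrow> real ^ 'n ^ 'n \<Rightarrow> 'n \<times> 'n \<Rightarrow> real" where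
  "other_entries i B = (\<lambda>(k, l) \<in> - {(i, i)}. B $ k $ l)"

text \<open>
  The family of all other entries is a single random element of the product space
  indexed by the pairs different from \<open>(i, i)\<close>, so independence is from the joint family
  and not merely from each other entry separately. The library's \<open>indep_var\<close> requires both
  random variables to have the same value type; here the types differ, so independence is
  stated for the generated \<open>\<sigma>\<close>-algebras.
\<close>

definition diag_entry_indep_of_others ::
    "'a measure \<Rightarrow> ('a \<Rightarrow> real ^ 'n ^ 'n) \<Rightarrow> 'n::finite \<Rightarrow> bool" where
  "diag_entry_indep_of_others M T i \<longleftrightarrow>
     prob_space.indep_set M
       (sets (vimage_algebra (space M) (\<lambda>\<omega>. T \<omega> $ i $ i) borel))
       (sets (vimage_algebra (space M) (\<lambda>\<omega>. other_entries i (T \<omega>))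
          (Pi\<^sub>M (- {(i, i)}) (\<lambda>_. borel))))"

end

theory Submission imports Defs begin

text \<open>
  Fill the matrix \<open>B = A + T\<close> in one row at a time, starting from the identity: for a set \<open>S\<close>
  of indices let \<open>D\<^sub>S\<close> be the principal minor of \<open>B\<close> on \<open>S\<close>, so that \<open>D\<close> is \<open>1\<close> on the empty
  set and \<open>det B\<close> on the full index set. For \<open>i \<notin> S\<close>, Laplace expansion gives
  \<open>D\<^bsub>insert i S\<^esub> = g + T\<^sub>i\<^sub>i * D\<^sub>S\<close>, where neither \<open>g\<close> nor \<open>D\<^sub>S\<close> involves \<open>T\<^sub>i\<^sub>i\<close>
  (\<open>row_masked_det_insert\<close>). Freezing all other entries, the event
  \<open>D\<^sub>S \<noteq> 0 \<and> \<bar>D\<^bsub>insert i S\<^esub>\<bar> \<le> t * \<bar>D\<^sub>S\<bar>\<close> confines \<open>T\<^sub>i\<^sub>i\<close> to an interval of length \<open>2 * t\<close>.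
  As \<open>T\<^sub>i\<^sub>i\<close> is independent of the frozen entries and has a density bounded by \<open>b\<close>, Fubini bounds
  the probability of this event by \<open>2 * b * t\<close> (\<open>prob_affine_small_ball\<close>).

  If the event fails at each of the \<open>n\<close> steps from the empty set to the full index set, then each
  step multiplies the absolute value of the minor by more than \<open>t\<close> and keeps it nonzero, whence
  \<open>\<bar>det B\<bar> > t ^ n\<close>. The union bound over the \<open>n\<close> steps gives \<open>2 * b * n * t\<close>.
\<close>

section \<open>Principal minors\<close>

text \<open>
  Replacing the rows outside \<open>S\<close> by identity rows leaves a matrix whose determinant is the
  principal minor on \<open>S\<close>; in this form all minors have the same matrix type.
\<close>

definition row_masked_det :: "'n::finite set \<Rightarrow> real ^ 'n ^ 'n \<Rightarrow> real" where
  "row_masked_det S B = det (\<chi> k. if k \<in> S then row k B else axis k 1)"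

lemma row_masked_det_empty:
  fixes B :: "real ^ 'n ^ 'n"
  shows "row_masked_det {} B = 1"
proof -
  have "(\<chi> k. axis k 1) = (mat 1 :: real ^ 'n ^ 'n)"
    by (auto simp: vec_eq_iff mat_def axis_def)
  then show ?thesis
    by (simp add: row_masked_det_def)
qed

lemma row_masked_det_UNIV: "row_masked_det UNIV B = det B"
proof -
  have "(\<chi> k. row k B) = B"
    by (simp add: vec_eq_iff row_def)
  then show ?thesis
    by (simp add: row_masked_det_def)
qed

definition add_diag :: "'n::finite \<Rightarrow> real \<Rightarrow> real ^ 'n ^ 'n \<Rightarrow> real ^ 'n ^ 'n" where
  "add_diag i x B = (\<chi> k l. B $ k $ l + (if k = i \<and> l = i then x else 0))"

lemma row_masked_det_add_diag:
  assumes "i \<notin> S"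
  shows "row_masked_det S (add_diag i x B) = row_masked_det S B"
proof -
  have "row k (add_diag i x B) = row k B" if "k \<in> S" for k
    using that assms by (auto simp: vec_eq_iff row_def add_diag_def)
  then show ?thesis
    unfolding row_masked_det_def by (metis (lifting))
qed

text \<open>
  The determinant is linear in row \<open>i\<close>, and row \<open>i\<close> changes by \<open>x\<close> times the \<open>i\<close>-th unit vector,
  which is the row that the mask puts there when \<open>i \<notin> S\<close>.
\<close>

lemma row_masked_det_insert:
  assumes "i \<notin> S"
  shows "row_masked_det (insert i S) (add_diag i x B)
           = row_masked_det (insert i S) B + x * row_masked_det S B"
proof -
  define c where "c = (\<lambda>k. if k \<in> S then row k B else axis k 1)"
  have row_i: "row i (add_diag i x B) = row i B + x *s axis i 1"
    by (auto simp: vec_eq_iff row_def add_diag_def axis_def)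
  have row_k: "row k (add_diag i x B) = row k B" if "k \<noteq> i" for k
    using that by (auto simp: vec_eq_iff row_def add_diag_def)
  have "row_masked_det (insert i S) (add_diag i x B)
      = det (\<chi> k. if k = i then row i B + x *s axis i 1 else c k)"
    unfolding row_masked_det_def
    by (rule arg_cong[of _ _ det]) (auto simp: vec_eq_iff c_def row_i row_k)
  also have "\<dots> = det (\<chi> k. if k = i then row i B else c k)
      + x * det (\<chi> k. if k = i then axis i 1 else c k)"
    by (simp add: det_row_add det_row_mul)
  also have "(\<chi> k. if k = i then row i B else c k)
      = (\<chi> k. if k \<in> insert i S then row k B else axis k 1)"
    by (auto simp: vec_eq_iff c_def)
  also have "(\<chi> k. if k = i then axis i 1 else c k)
      = (\<chi> k. if k \<in> S then row k B else axis k 1)"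
    using assms by (auto simp: vec_eq_iff c_def)
  finally show ?thesis
    by (simp add: row_masked_det_def)
qed

lemma borel_measurable_row_masked_det:
  assumes "\<And>k l. (\<lambda>\<omega>. B \<omega> $ k $ l) \<in> borel_measurable M"
  shows "(\<lambda>\<omega>. row_masked_det S (B \<omega>)) \<in> borel_measurable M"
proof -
  have entry: "(\<lambda>\<omega>. (if k \<in> S then row k (B \<omega>) else axis k 1) $ l) \<in> borel_measurable M" for k l
    using assms by (cases "k \<in> S") (simp_all add: row_def)
  show ?thesis
    unfolding row_masked_det_def det_def
    by (intro borel_measurable_sum borel_measurable_times borel_measurable_prod
        borel_measurable_const) (simp add: entry)
qed

section \<open>Small balls for affine functions of an independent variable\<close>

lemma emeasure_density_interval_le:
  assumes [measurable]: "f \<in> borel_measurable lborel"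
    and bound: "AE x in lborel. f x \<le> ennreal b"
    and "b \<ge> 0" "t \<ge> 0"
  shows "emeasure (density lborel f) {c - t..c + t} \<le> ennreal (2 * b * t)"
proof -
  have "emeasure (density lborel f) {c - t..c + t}
      = (\<integral>\<^sup>+x. f x * indicator {c - t..c + t} x \<partial>lborel)"
    by (simp add: emeasure_density)
  also have "\<dots> \<le> (\<integral>\<^sup>+x. ennreal b * indicator {c - t..c + t} x \<partial>lborel)"
    using bound by (intro nn_integral_mono_AE) (auto split: split_indicator)
  also have "\<dots> = ennreal b * ennreal (2 * t)"
    using \<open>t \<ge> 0\<close> by (simp add: nn_integral_cmult)
  also have "\<dots> = ennreal (2 * b * t)"
    using \<open>b \<ge> 0\<close> \<open>t \<ge> 0\<close> by (simp add: ennreal_mult[symmetric] mult_ac)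
  finally show ?thesis .
qed

text \<open>
  The two variables may take values in different types, so independence is that of their generated
  \<open>\<sigma>\<close>-algebras; it says that the joint law and the product law agree on rectangles.
\<close>

lemma (in prob_space) distr_Pair_of_indep_vimage_algebras:
  assumes [measurable]: "X \<in> M \<rightarrow>\<^sub>M K" "Y \<in> M \<rightarrow>\<^sub>M N"
    and indep: "indep_set (sets (vimage_algebra (space M) X K)) (sets (vimage_algebra (space M) Y N))"
  shows "distr M (K \<Otimes>\<^sub>M N) (\<lambda>\<omega>. (X \<omega>, Y \<omega>)) = distr M K X \<Otimes>\<^sub>M distr M N Y"
proof -
  interpret X: prob_space "distr M K X" by (rule prob_space_distr) simp
  interpret Y: prob_space "distr M N Y" by (rule prob_space_distr) simp
  show ?thesis
  proof (rule pair_measure_eqI[symmetric])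
    fix P Q assume "P \<in> sets (distr M K X)" "Q \<in> sets (distr M N Y)"
    then have [measurable]: "P \<in> sets K" "Q \<in> sets N" by simp_all
    have "prob ((X -` P \<inter> space M) \<inter> (Y -` Q \<inter> space M))
        = prob (X -` P \<inter> space M) * prob (Y -` Q \<inter> space M)"
      by (rule indep_setD[OF indep]) (simp_all add: in_vimage_algebra)
    moreover have "(\<lambda>\<omega>. (X \<omega>, Y \<omega>)) -` (P \<times> Q) \<inter> space M
        = (X -` P \<inter> space M) \<inter> (Y -` Q \<inter> space M)"
      by auto
    ultimately show "emeasure (distr M K X) P * emeasure (distr M N Y) Q
        = emeasure (distr M (K \<Otimes>\<^sub>M N) (\<lambda>\<omega>. (X \<omega>, Y \<omega>))) (P \<times> Q)"
      by (simp add: emeasure_distr emeasure_eq_measure ennreal_mult)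
  qed (auto intro: X.sigma_finite_measure Y.sigma_finite_measure)
qed

text \<open>
  Dividing by \<open>h y \<noteq> 0\<close> turns the condition on \<open>x\<close> into membership in the interval of radius \<open>t\<close>
  around \<open>- g y / h y\<close>. The bound for each fixed \<open>y\<close> survives integration over the law of \<open>Y\<close>.
\<close>

lemma (in prob_space) prob_affine_small_ball:
  assumes X: "distributed M lborel X f"
    and bound: "AE x in lborel. f x \<le> ennreal b"
    and nonneg: "b \<ge> 0" "t \<ge> 0"
    and Y [measurable]: "Y \<in> M \<rightarrow>\<^sub>M N"
    and indep: "indep_set (sets (vimage_algebra (space M) X borel))
                          (sets (vimage_algebra (space M) Y N))"
    and [measurable]: "g \<in> borel_measurable N" "h \<in> borel_measurable N"
  shows "prob {\<omega> \<in> space M. h (Y \<omega>) \<noteq> 0 \<and> \<bar>g (Y \<omega>) + X \<omega> * h (Y \<omega>)\<bar> \<le> t * \<bar>h (Y \<omega>)\<bar>}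
           \<le> 2 * b * t"
proof -
  have X_borel [measurable]: "X \<in> borel_measurable M"
    using distributed_measurable[OF X] by simp
  have f [measurable]: "f \<in> borel_measurable lborel"
    using distributed_borel_measurable[OF X] .
  have law: "distr M borel X = density lborel f"
    using distributed_distr_eq_density[OF X] by (metis distr_cong sets_lborel)
  interpret X: prob_space "distr M borel X" by (rule prob_space_distr) simp
  interpret Y: prob_space "distr M N Y" by (rule prob_space_distr) simp
  interpret XY: pair_sigma_finite "distr M borel X" "distr M N Y" ..
  define W where "W = {p \<in> space (borel \<Otimes>\<^sub>M N).
    h (snd p) \<noteq> 0 \<and> \<bar>g (snd p) + fst p * h (snd p)\<bar> \<le> t * \<bar>h (snd p)\<bar>}"
  have W [measurable]: "W \<in> sets (borel \<Otimes>\<^sub>M N)"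
    unfolding W_def by measurable
  have slice: "emeasure (distr M borel X) ((\<lambda>x. (x, y)) -` W) \<le> ennreal (2 * b * t)" for y
  proof (cases "h y = 0")
    case True
    then have "(\<lambda>x. (x, y)) -` W = {}" by (auto simp: W_def)
    then show ?thesis by simp
  next
    case False
    have "(\<lambda>x. (x, y)) -` W \<subseteq> {- g y / h y - t..- g y / h y + t}"
    proof
      fix x assume "x \<in> (\<lambda>x. (x, y)) -` W"
      then have "\<bar>g y + x * h y\<bar> \<le> t * \<bar>h y\<bar>" by (simp add: W_def)
      moreover have "g y + x * h y = (x - (- g y / h y)) * h y"
        using False by (simp add: field_simps)
      ultimately have "\<bar>x - (- g y / h y)\<bar> \<le> t"
        using False by (simp add: abs_mult)
      then show "x \<in> {- g y / h y - t..- g y / h y + t}" by (simp add: abs_le_iff)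
    qed
    then have "emeasure (distr M borel X) ((\<lambda>x. (x, y)) -` W)
        \<le> emeasure (distr M borel X) {- g y / h y - t..- g y / h y + t}"
      by (rule emeasure_mono) simp
    also have "\<dots> \<le> ennreal (2 * b * t)"
      unfolding law by (rule emeasure_density_interval_le[OF f bound nonneg])
    finally show ?thesis .
  qed
  have "{\<omega> \<in> space M. h (Y \<omega>) \<noteq> 0 \<and> \<bar>g (Y \<omega>) + X \<omega> * h (Y \<omega>)\<bar> \<le> t * \<bar>h (Y \<omega>)\<bar>}
      = (\<lambda>\<omega>. (X \<omega>, Y \<omega>)) -` W \<inter> space M"
    using measurable_space[OF Y] by (auto simp: W_def space_pair_measure)
  then have "emeasure M {\<omega> \<in> space M.
        h (Y \<omega>) \<noteq> 0 \<and> \<bar>g (Y \<omega>) + X \<omega> * h (Y \<omega>)\<bar> \<le> t * \<bar>h (Y \<omega>)\<bar>}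
      = emeasure (distr M (borel \<Otimes>\<^sub>M N) (\<lambda>\<omega>. (X \<omega>, Y \<omega>))) W"
    by (simp add: emeasure_distr)
  also have "\<dots> = emeasure (distr M borel X \<Otimes>\<^sub>M distr M N Y) W"
    using distr_Pair_of_indep_vimage_algebras[OF X_borel Y indep] by simp
  also have "\<dots> = (\<integral>\<^sup>+y. emeasure (distr M borel X) ((\<lambda>x. (x, y)) -` W) \<partial>distr M N Y)"
    by (rule XY.emeasure_pair_measure_alt2) simp
  also have "\<dots> \<le> (\<integral>\<^sup>+y. ennreal (2 * b * t) \<partial>distr M N Y)"
    by (intro nn_integral_mono slice)
  also have "\<dots> = ennreal (2 * b * t)"
    by (simp add: Y.emeasure_space_1 del: space_distr)
  finally show ?thesis
    using nonneg by (simp add: emeasure_eq_measure)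
qed

section \<open>Growth of the minors\<close>

lemma (in prob_space) prob_minor_ratio_small:
  fixes T :: "'a \<Rightarrow> real ^ 'n ^ 'n" and f :: "real \<Rightarrow> ennreal"
  assumes T: "T \<in> borel_measurable M"
    and dens: "distributed M lborel (\<lambda>\<omega>. T \<omega> $ i $ i) f"
    and indep: "diag_entry_indep_of_others M T i"
    and bound: "AE x in lborel. f x \<le> ennreal b"
    and nonneg: "b \<ge> 0" "t \<ge> 0"
    and "i \<notin> S"
  shows "prob {\<omega> \<in> space M. row_masked_det S (A + T \<omega>) \<noteq> 0 \<and>
             \<bar>row_masked_det (insert i S) (A + T \<omega>)\<bar> \<le> t * \<bar>row_masked_det S (A + T \<omega>)\<bar>}
           \<le> 2 * b * t"
proof -
  let ?N = "Pi\<^sub>M (- {(i, i)}) (\<lambda>_. borel :: real measure)"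
  \<comment> \<open>The matrix \<open>A + T\<close> with \<open>T\<^sub>i\<^sub>i\<close> replaced by \<open>0\<close>, as a function of the other entries of \<open>T\<close>.\<close>
  define B where "B = (\<lambda>y. \<chi> k l. A $ k $ l + (if k = i \<and> l = i then 0 else y (k, l)))"
  have entry: "(\<lambda>\<omega>. T \<omega> $ k $ l) \<in> borel_measurable M" for k l
  proof -
    have "(\<lambda>C :: real ^ 'n ^ 'n. C $ k $ l) \<in> borel_measurable borel"
      by (intro borel_measurable_continuous_onI continuous_intros)
    from measurable_compose[OF T this] show ?thesis .
  qed
  have Y: "(\<lambda>\<omega>. other_entries i (T \<omega>)) \<in> M \<rightarrow>\<^sub>M ?N"
    unfolding other_entries_def by (rule measurable_restrict) (auto simp: split_beta entry)
  have "(\<lambda>y. B y $ k $ l) \<in> borel_measurable ?N" for k l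
  proof (cases "k = i \<and> l = i")
    case False
    then have "(\<lambda>y. y (k, l)) \<in> borel_measurable ?N"
      by (intro measurable_component_singleton) auto
    with False show ?thesis by (auto simp: B_def)
  qed (simp add: B_def)
  then have D: "(\<lambda>y. row_masked_det R (B y)) \<in> borel_measurable ?N" for R
    by (rule borel_measurable_row_masked_det)
  have "A + T \<omega> = add_diag i (T \<omega> $ i $ i) (B (other_entries i (T \<omega>)))" for \<omega>
    by (auto simp: vec_eq_iff add_diag_def B_def other_entries_def)
  then show ?thesis
    using prob_affine_small_ball[OF dens bound nonneg Y
        indep[unfolded diag_entry_indep_of_others_def] D[of "insert i S"] D[of S]]
    by (simp add: row_masked_det_insert row_masked_det_add_diag \<open>i \<notin> S\<close>)
qed

text \<open>
  The event includes the vanishing of the minor so that the next ratio is defined outside it. At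
  \<open>S = {}\<close> the minor equals \<open>t ^ card S\<close> surely, so there the comparison has to be left out.
\<close>

lemma (in prob_space) prob_minor_small:
  fixes T :: "'a \<Rightarrow> real ^ 'n ^ 'n" and f :: "'n::finite \<Rightarrow> real \<Rightarrow> ennreal"
  assumes T: "T \<in> borel_measurable M"
    and dens: "\<And>i. distributed M lborel (\<lambda>\<omega>. T \<omega> $ i $ i) (f i)"
    and indep: "\<And>i. diag_entry_indep_of_others M T i"
    and bound: "\<And>i. AE x in lborel. f i x \<le> ennreal b"
    and nonneg: "b \<ge> 0" "t \<ge> 0"
  shows "prob {\<omega> \<in> space M. row_masked_det S (A + T \<omega>) = 0 \<or>
             S \<noteq> {} \<and> \<bar>row_masked_det S (A + T \<omega>)\<bar> \<le> t ^ card S}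
           \<le> 2 * b * real (card S) * t"
    (is "prob (?small S) \<le> _")
proof -
  have "(\<lambda>\<omega>. (A + T \<omega>) $ k $ l) \<in> borel_measurable M" for k l
  proof -
    have "(\<lambda>C. (A + C) $ k $ l) \<in> borel_measurable borel"
      by (intro borel_measurable_continuous_onI continuous_intros)
    from measurable_compose[OF T this] show ?thesis .
  qed
  then have D [measurable]: "(\<lambda>\<omega>. row_masked_det R (A + T \<omega>)) \<in> borel_measurable M" for R
    by (rule borel_measurable_row_masked_det)
  have "finite S" by simp
  then show ?thesis
  proof (induction S rule: finite_induct)
    case empty
    then show ?case by (simp add: row_masked_det_empty)
  next
    case (insert i S)
    let ?ratio = "{\<omega> \<in> space M. row_masked_det S (A + T \<omega>) \<noteq> 0 \<and>
      \<bar>row_masked_det (insert i S) (A + T \<omega>)\<bar> \<le> t * \<bar>row_masked_det S (A + T \<omega>)\<bar>}"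
    have "?small (insert i S) \<subseteq> ?small S \<union> ?ratio"
    proof
      fix \<omega> assume small: "\<omega> \<in> ?small (insert i S)"
      let ?D = "\<lambda>R. \<bar>row_masked_det R (A + T \<omega>)\<bar>"
      have le: "?D (insert i S) \<le> t * t ^ card S"
        using small insert.hyps \<open>t \<ge> 0\<close> by auto
      show "\<omega> \<in> ?small S \<union> ?ratio"
      proof (rule ccontr)
        assume "\<omega> \<notin> ?small S \<union> ?ratio"
        with small have gt: "?D (insert i S) > t * ?D S"
          and "S \<noteq> {} \<longrightarrow> ?D S > t ^ card S" by auto
        then have "t ^ card S \<le> ?D S"
          by (cases "S = {}") (auto simp: row_masked_det_empty)
        then have "t * t ^ card S \<le> t * ?D S"
          using \<open>t \<ge> 0\<close> by (rule mult_left_mono)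
        with le gt show False by linarith
      qed
    qed
    then have "prob (?small (insert i S)) \<le> prob (?small S \<union> ?ratio)"
      by (rule finite_measure_mono) measurable
    also have "\<dots> \<le> prob (?small S) + prob ?ratio"
      by (rule measure_Un_le) measurable
    also have "\<dots> \<le> 2 * b * real (card S) * t + 2 * b * t"
      by (intro add_mono insert.IH
          prob_minor_ratio_small[OF T dens indep bound nonneg] insert.hyps)
    also have "\<dots> = 2 * b * real (card (insert i S)) * t"
      using insert.hyps by (simp add: algebra_simps)
    finally show ?case .
  qed
qed

theorem theorem1p1:
  fixes M :: "'a measure"
    and T :: "'a \<Rightarrow> real ^ 'n ^ 'n"
    and f :: "'n::finite \<Rightarrow> real \<Rightarrow> ennreal"
    and A :: "real ^ 'n ^ 'n"
    and b t :: real
  assumes "prob_space M"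
    and "T \<in> borel_measurable M"
    and "\<And>i. distributed M lborel (\<lambda>\<omega>. T \<omega> $ i $ i) (f i)"
    and "\<And>i. diag_entry_indep_of_others M T i"
    and "b > 0"
    and "\<And>i. AE x in lborel. f i x \<le> ennreal b"
    and "t \<ge> 0"
  shows "measure M {\<omega> \<in> space M. \<bar>det (A + T \<omega>)\<bar> powr (1 / real CARD('n)) \<le> t}
           \<le> 2 * b * real CARD('n) * t"
proof -
  interpret prob_space M by fact
  let ?small = "{\<omega> \<in> space M. row_masked_det UNIV (A + T \<omega>) = 0 \<or>
    (UNIV :: 'n set) \<noteq> {} \<and> \<bar>row_masked_det UNIV (A + T \<omega>)\<bar> \<le> t ^ CARD('n)}"
  have "(\<lambda>C :: real ^ 'n ^ 'n. (A + C) $ k $ l) \<in> borel_measurable borel" for k l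
    by (intro borel_measurable_continuous_onI continuous_intros)
  then have [measurable]: "(\<lambda>\<omega>. row_masked_det UNIV (A + T \<omega>)) \<in> borel_measurable M"
    by (intro borel_measurable_row_masked_det measurable_compose[OF assms(2)])
  have root: "x \<le> t ^ CARD('n)" if "x powr (1 / real CARD('n)) \<le> t" "x \<ge> 0" for x :: real
  proof -
    have "x = (x powr (1 / real CARD('n))) ^ CARD('n)"
      using \<open>x \<ge> 0\<close> by (cases "x = 0") (simp_all add: powr_power)
    also have "\<dots> \<le> t ^ CARD('n)"
      using that by (intro power_mono) simp_all
    finally show ?thesis .
  qed
  have "?small \<in> events"
    by measurable
  then have "prob {\<omega> \<in> space M. \<bar>det (A + T \<omega>)\<bar> powr (1 / real CARD('n)) \<le> t} \<le> prob ?small"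
    by (intro finite_measure_mono) (auto simp flip: row_masked_det_UNIV intro: root)
  also have "\<dots> \<le> 2 * b * real CARD('n) * t"
    using assms by (intro prob_minor_small) auto
  finally show ?thesis .
qed

end
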